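(* Let $N$ and $H$ be groups, $\phi:H\to Sym(N)_1$ a group homomorphism, and $L=N\rtimes_\phi H$ the corresponding loop. Then the left nucleus $N_\lambda(L)$ is a group (under the operation of $L$).
   Context: $Sym(N)_1$ is the stabilizer of the identity $1\in N$ in the group of all permutations of $N$; write $\phi_h=\phi(h)$. $N\rtimes_\phi H$ is the loop on $N\times H$ with operation $(n_1,h_1)(n_2,h_2)=(n_1\phi_{h_1}(n_2),h_1h_2)$. The left nucleus is $N_\lambda(L)=\{a\in L\mid a(xy)=(ax)y\ \forall x,y\in L\}$. *)

theory Defs
  imports "HOL-Algebra.Group_Action"
begin

locale loop =
  fixes L (structure)
  assumes m_closed: "\<lbrakk>x \<in> carrier L; y \<in> carrier L\<rbrakk> \<Longrightarrow> x \<otimes> y \<in> carrier L"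
    and one_closed: "\<one> \<in> carrier L"
    and l_one: "x \<in> carrier L \<Longrightarrow> \<one> \<otimes> x = x"
    and r_one: "x \<in> carrier L \<Longrightarrow> x \<otimes> \<one> = x"
    and l_div: "\<lbrakk>a \<in> carrier L; b \<in> carrier L\<rbrakk> \<Longrightarrow> \<exists>!x. x \<in> carrier L \<and> a \<otimes> x = b"
    and r_div: "\<lbrakk>a \<in> carrier L; b \<in> carrier L\<rbrakk> \<Longrightarrow> \<exists>!y. y \<in> carrier L \<and> y \<otimes> a = b"

definition left_nucleus :: "('a, 'm) monoid_scheme \<Rightarrow> 'a set"
  where "left_nucleus L =
    {a \<in> carrier L. \<forall>x \<in> carrier L. \<forall>y \<in> carrier L.
       a \<otimes>\<^bsub>L\<^esub> (x \<otimes>\<^bsub>L\<^esub> y) = (a \<otimes>\<^bsub>L\<^esub> x) \<otimes>\<^bsub>L\<^esub> y}"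

text \<open>The product in \<open>BijGroup\<close> is composition \<open>f \<circ> g\<close> (left actions). Its elements are
  extensional functions, so each permutation of the carrier is represented exactly once.\<close>

definition Sym1 :: "('a, 'm) monoid_scheme \<Rightarrow> ('a \<Rightarrow> 'a) monoid"
  where "Sym1 N =
    (BijGroup (carrier N))\<lparr>carrier := stabilizer (BijGroup (carrier N)) (\<lambda>f. f) \<one>\<^bsub>N\<^esub>\<rparr>"

definition semidirect_loop ::
    "('a, 'm) monoid_scheme \<Rightarrow> ('b, 'n) monoid_scheme \<Rightarrow> ('b \<Rightarrow> 'a \<Rightarrow> 'a) \<Rightarrow> ('a \<times> 'b) monoid"
  where "semidirect_loop N H \<phi> =
    \<lparr>carrier = carrier N \<times> carrier H,
     mult = (\<lambda>(n1, h1) (n2, h2). (n1 \<otimes>\<^bsub>N\<^esub> \<phi> h1 n2, h1 \<otimes>\<^bsub>H\<^esub> h2)),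
     one = (\<one>\<^bsub>N\<^esub>, \<one>\<^bsub>H\<^esub>)\<rparr>"

lemma carrier_Sym1: "carrier (Sym1 N) = {f \<in> Bij (carrier N). f \<one>\<^bsub>N\<^esub> = \<one>\<^bsub>N\<^esub>}"
  by (simp add: Sym1_def stabilizer_def BijGroup_def)

lemma Sym1_group:
  assumes "group N"
  shows "group (Sym1 N)"
proof -
  interpret N: group N by fact
  interpret group_action "BijGroup (carrier N)" "carrier N" "\<lambda>f. f"
    by (intro group_action.intro group_hom.intro group_hom_axioms.intro group_BijGroup)
      (simp add: hom_def)
  show ?thesis
    unfolding Sym1_def
    by (intro subgroup.subgroup_is_group stabilizer_subgroup group_BijGroup) simp
qed

lemma semidirect_loop_is_loop:
  assumes "group N" "group H" "\<phi> \<in> hom H (Sym1 N)"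
  shows "loop (semidirect_loop N H \<phi>)"
proof -
  interpret N: group N by fact
  interpret H: group H by fact
  have S: "group_hom H (Sym1 N) \<phi>"
    using assms Sym1_group[OF assms(1)] by (simp add: group_hom_def group_hom_axioms_def)
  have bij: "bij_betw (\<phi> h) (carrier N) (carrier N)"
    and fix1: "\<phi> h \<one>\<^bsub>N\<^esub> = \<one>\<^bsub>N\<^esub>" if "h \<in> carrier H" for h
    using group_hom.hom_closed[OF S that] by (auto simp: carrier_Sym1 Bij_def)
  have cl: "\<phi> h n \<in> carrier N" if "h \<in> carrier H" "n \<in> carrier N" for h n
    using bij[OF that(1)] that(2) by (auto dest: bij_betwE)
  have one: "\<phi> \<one>\<^bsub>H\<^esub> n = n" if "n \<in> carrier N" for n
    using group_hom.hom_one[OF S] that by (simp add: Sym1_def BijGroup_def)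
  let ?L = "semidirect_loop N H \<phi>"
  have ldiv: "\<exists>!x. x \<in> carrier ?L \<and> a \<otimes>\<^bsub>?L\<^esub> x = b"
    if ab: "a \<in> carrier ?L" "b \<in> carrier ?L" for a b
  proof -
    obtain m h n k where ab': "a = (m, h)" "b = (n, k)" "m \<in> carrier N" "n \<in> carrier N"
      "h \<in> carrier H" "k \<in> carrier H"
      using ab by (auto simp: semidirect_loop_def)
    have inj: "inj_on (\<phi> h) (carrier N)" and im: "\<phi> h ` carrier N = carrier N"
      using bij ab' by (auto simp: bij_betw_def)
    have "inv\<^bsub>N\<^esub> m \<otimes>\<^bsub>N\<^esub> n \<in> \<phi> h ` carrier N"
      using im ab' by simp
    then obtain x where x: "x \<in> carrier N" "\<phi> h x = inv\<^bsub>N\<^esub> m \<otimes>\<^bsub>N\<^esub> n"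
      by force
    have xu: "y = x" if "y \<in> carrier N" "\<phi> h y = inv\<^bsub>N\<^esub> m \<otimes>\<^bsub>N\<^esub> n" for y
      using inj_onD[OF inj _ that(1) x(1)] x(2) that(2) by simp
    show ?thesis
    proof (rule ex1I[of _ "(x, inv\<^bsub>H\<^esub> h \<otimes>\<^bsub>H\<^esub> k)"])
      show "(x, inv\<^bsub>H\<^esub> h \<otimes>\<^bsub>H\<^esub> k) \<in> carrier ?L \<and> a \<otimes>\<^bsub>?L\<^esub> (x, inv\<^bsub>H\<^esub> h \<otimes>\<^bsub>H\<^esub> k) = b"
        using ab' x by (simp add: semidirect_loop_def N.m_assoc[symmetric] H.m_assoc[symmetric])
    next
      fix z assume z: "z \<in> carrier ?L \<and> a \<otimes>\<^bsub>?L\<^esub> z = b"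
      then obtain y l where zy: "z = (y, l)" "y \<in> carrier N" "l \<in> carrier H"
        "m \<otimes>\<^bsub>N\<^esub> \<phi> h y = n" "h \<otimes>\<^bsub>H\<^esub> l = k"
        using ab' by (auto simp: semidirect_loop_def)
      then show "z = (x, inv\<^bsub>H\<^esub> h \<otimes>\<^bsub>H\<^esub> k)"
        using ab' xu[of y] cl[of h y] by (auto simp: N.inv_solve_left H.inv_solve_left)
    qed
  qed
  have rdiv: "\<exists>!y. y \<in> carrier ?L \<and> y \<otimes>\<^bsub>?L\<^esub> a = b"
    if ab: "a \<in> carrier ?L" "b \<in> carrier ?L" for a b
  proof -
    obtain m h n k where ab': "a = (m, h)" "b = (n, k)" "m \<in> carrier N" "n \<in> carrier N"
      "h \<in> carrier H" "k \<in> carrier H"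
      using ab by (auto simp: semidirect_loop_def)
    define l where "l = k \<otimes>\<^bsub>H\<^esub> inv\<^bsub>H\<^esub> h"
    have l: "l \<in> carrier H" using ab' by (simp add: l_def)
    show ?thesis
    proof (rule ex1I[of _ "(n \<otimes>\<^bsub>N\<^esub> inv\<^bsub>N\<^esub> (\<phi> l m), l)"])
      show "(n \<otimes>\<^bsub>N\<^esub> inv\<^bsub>N\<^esub> (\<phi> l m), l) \<in> carrier ?L \<and>
        (n \<otimes>\<^bsub>N\<^esub> inv\<^bsub>N\<^esub> (\<phi> l m), l) \<otimes>\<^bsub>?L\<^esub> a = b"
        using ab' l cl[of l m]
        by (simp add: semidirect_loop_def N.m_assoc) (simp add: l_def H.m_assoc)
    next
      fix z assume z: "z \<in> carrier ?L \<and> z \<otimes>\<^bsub>?L\<^esub> a = b"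
      then obtain y g where zy: "z = (y, g)" "y \<in> carrier N" "g \<in> carrier H"
        "y \<otimes>\<^bsub>N\<^esub> \<phi> g m = n" "g \<otimes>\<^bsub>H\<^esub> h = k"
        using ab' by (auto simp: semidirect_loop_def)
      then have "g = l" using ab' by (auto simp: l_def H.m_assoc)
      then show "z = (n \<otimes>\<^bsub>N\<^esub> inv\<^bsub>N\<^esub> (\<phi> l m), l)"
        using zy ab' cl[of l m] by (auto simp: N.m_assoc)
    qed
  qed
  show ?thesis
    by (rule loop.intro[OF _ _ _ _ ldiv rdiv])
      (auto simp: semidirect_loop_def cl one fix1)
qed

end

theory Submission
  imports Defs
begin

text \<open>
  The particular shape of the semidirect product matters only in that it is a loop
  (\<open>semidirect_loop_is_loop\<close>): in every loop the left nucleus is a group. The law defining the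
  nucleus makes its elements associate whenever they stand leftmost. This gives associativity
  inside the nucleus, and also closure, since an outer factor \<open>a b\<close> can be unfolded and refolded
  one nuclear element at a time. The one substantial point is inverses
  (\<open>right_inverse_in_left_nucleus\<close>): the right inverse of a nuclear \<open>a\<close> exists by division, and it
  is again nuclear and also a left inverse because both equations can be checked after
  multiplication by \<open>a\<close> on the left, which is injective.
\<close>

context loop
begin

lemma left_nucleus_carrier: "a \<in> left_nucleus L \<Longrightarrow> a \<in> carrier L"
  by (simp add: left_nucleus_def)

lemma left_nucleus_assoc:
  "\<lbrakk>a \<in> left_nucleus L; x \<in> carrier L; y \<in> carrier L\<rbrakk> \<Longrightarrow> a \<otimes> (x \<otimes> y) = (a \<otimes> x) \<otimes> y"
  by (simp add: left_nucleus_def)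

lemma l_cancel:
  assumes "a \<in> carrier L" "x \<in> carrier L" "y \<in> carrier L" "a \<otimes> x = a \<otimes> y"
  shows "x = y"
  using l_div[OF assms(1) m_closed[OF assms(1,3)]] assms by auto

lemma one_in_left_nucleus: "\<one> \<in> left_nucleus L"
  by (simp add: left_nucleus_def one_closed l_one m_closed)

lemma left_nucleus_m_closed:
  assumes a: "a \<in> left_nucleus L" and b: "b \<in> left_nucleus L"
  shows "a \<otimes> b \<in> left_nucleus L"
proof -
  note carr = left_nucleus_carrier[OF a] left_nucleus_carrier[OF b]
  have "(a \<otimes> b) \<otimes> (x \<otimes> y) = ((a \<otimes> b) \<otimes> x) \<otimes> y" if xy: "x \<in> carrier L" "y \<in> carrier L" for x y
  proof -
    have "(a \<otimes> b) \<otimes> (x \<otimes> y) = a \<otimes> (b \<otimes> (x \<otimes> y))"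
      using left_nucleus_assoc[OF a] carr xy m_closed by simp
    also have "\<dots> = a \<otimes> ((b \<otimes> x) \<otimes> y)"
      using left_nucleus_assoc[OF b] xy by simp
    also have "\<dots> = (a \<otimes> (b \<otimes> x)) \<otimes> y"
      using left_nucleus_assoc[OF a] carr xy m_closed by simp
    also have "\<dots> = ((a \<otimes> b) \<otimes> x) \<otimes> y"
      using left_nucleus_assoc[OF a] carr xy by simp
    finally show ?thesis .
  qed
  then show ?thesis
    using carr m_closed by (simp add: left_nucleus_def)
qed

text \<open>
  Associating with \<open>a\<close> outermost turns both \<open>a (b (x y))\<close> and \<open>a ((b x) y)\<close> into \<open>x y\<close>, so
  cancelling \<open>a\<close> shows that \<open>b\<close> is nuclear. Likewise \<open>a (b a) = (a b) a = a\<close> makes \<open>b\<close> a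
  two-sided inverse.
\<close>

lemma right_inverse_in_left_nucleus:
  assumes a: "a \<in> left_nucleus L" and b: "b \<in> carrier L" and ab: "a \<otimes> b = \<one>"
  shows "b \<in> left_nucleus L" and "b \<otimes> a = \<one>"
proof -
  note ac = left_nucleus_carrier[OF a]
  have undo: "a \<otimes> (b \<otimes> x) = x" if "x \<in> carrier L" for x
    using left_nucleus_assoc[OF a b that] that by (simp add: ab l_one)
  have "b \<otimes> (x \<otimes> y) = (b \<otimes> x) \<otimes> y" if xy: "x \<in> carrier L" "y \<in> carrier L" for x y
  proof (rule l_cancel[OF ac])
    have "a \<otimes> ((b \<otimes> x) \<otimes> y) = (a \<otimes> (b \<otimes> x)) \<otimes> y"
      using left_nucleus_assoc[OF a] b xy m_closed by simp
    then show "a \<otimes> (b \<otimes> (x \<otimes> y)) = a \<otimes> ((b \<otimes> x) \<otimes> y)"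
      using undo xy m_closed by simp
  qed (use b xy m_closed in auto)
  then show "b \<in> left_nucleus L"
    using b by (simp add: left_nucleus_def)
  show "b \<otimes> a = \<one>"
    by (rule l_cancel[OF ac]) (simp_all add: undo ac b m_closed one_closed r_one)
qed

theorem left_nucleus_is_group: "group (L\<lparr>carrier := left_nucleus L\<rparr>)"
proof (rule groupI, simp_all)
  fix a assume a: "a \<in> left_nucleus L"
  obtain b where "b \<in> carrier L" "a \<otimes> b = \<one>"
    using l_div[OF left_nucleus_carrier[OF a] one_closed] by blast
  then show "\<exists>b\<in>left_nucleus L. b \<otimes> a = \<one>"
    using right_inverse_in_left_nucleus[OF a] by blast
qed (simp_all add: left_nucleus_m_closed one_in_left_nucleus left_nucleus_carrier
  left_nucleus_assoc l_one)

end

theorem proposition3p11: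
  fixes N :: "('a, 'm) monoid_scheme"
    and H :: "('b, 'n) monoid_scheme"
    and \<phi> :: "'b \<Rightarrow> 'a \<Rightarrow> 'a"
    and L :: "('a \<times> 'b) monoid"
  assumes "group N"
    and "group H"
    and "\<phi> \<in> hom H (Sym1 N)"
    and "L = semidirect_loop N H \<phi>"
  shows "group (L\<lparr>carrier := left_nucleus L\<rparr>)"
  using loop.left_nucleus_is_group[OF semidirect_loop_is_loop[OF assms(1-3)]] assms(4) by simp

end
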